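(* Let $R$ be a ring as described in the context, with $v(x_1)=a_1$ and conductor valuation $c$. Then the reduced type $s(R)$ equals the number of integers in the interval $[c-a_1,c-1]$ that do not belong to the valuation semigroup $v(R)$.
   Context: $\Bbbk$ is an algebraically closed field of characteristic $0$. $(R,\mathfrak m,\Bbbk)$ is a non-regular one-dimensional complete local domain which is a $\Bbbk$-algebra, with integral closure $\overline R=\Bbbk[[t]]$ in its fraction field. Write $R\cong \Bbbk[[X_1,\dots,X_n]]/I$ with $I\subseteq (X_1,\dots,X_n)^2$, and let the image of $X_i$ be $x_i=\alpha_i t^{a_i}$ with $\alpha_i$ a unit of $\overline R$, arranged so that $a_1<a_2<\dots<a_n$ ($n\ge 2$ is the embedding dimension). $v$ is the $t$-adic order valuation on $\overline R$, and $v(R)=\{v(r):0\ne r\in R\}$. The conductor is $\mathfrak C=R:_{\operatorname{Frac}(R)}\overline R=t^c\overline R$, where the conductor valuation $c$ is the positive integer such that $t^{c-1}\notin R$ but $t^{c+i}\in R$ for all $i\ge 0$. The reduced type is $s(R)=\dim_\Bbbk\frac{\mathfrak C+x_1R}{x_1R}$. *)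

theory Defs
  imports
    "HOL-Algebra.Algebra"
    "HOL-Algebra.Algebraic_Closure_Type"
    "HOL-Computational_Algebra.Computational_Algebra"
    "HOL-Library.Extended_Nat"
begin

section \<open>Local rings\<close>

definition local_ring :: "('a, 'b) ring_scheme \<Rightarrow> 'a set \<Rightarrow> bool" where
  "local_ring A m \<longleftrightarrow> cring A \<and> noetherian_ring A \<and> {M. maximalideal M A} = {m}"

text \<open>The second conjunct says that \<open>A\<close> is \<open>I\<close>-adically separated, the third one that every compatible
  system of residue classes modulo the powers of \<open>I\<close> comes from an element of \<open>A\<close>; together
  they say that \<open>A\<close> is the inverse limit of the \<open>A / I\<^sup>k\<close>.\<close>

definition adically_complete :: "('a, 'b) ring_scheme \<Rightarrow> 'a set \<Rightarrow> bool" where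
  "adically_complete A I \<longleftrightarrow>
     ideal I A \<and>
     (\<Inter>k::nat. I [^]\<^bsub>ideals_set A\<^esub> k) = {\<zero>\<^bsub>A\<^esub>} \<and>
     (\<forall>s::nat \<Rightarrow> 'a.
        (\<forall>k. s k \<in> carrier A) \<longrightarrow>
        (\<forall>k. s (Suc k) \<ominus>\<^bsub>A\<^esub> s k \<in> I [^]\<^bsub>ideals_set A\<^esub> k) \<longrightarrow>
        (\<exists>y \<in> carrier A. \<forall>k. y \<ominus>\<^bsub>A\<^esub> s k \<in> I [^]\<^bsub>ideals_set A\<^esub> k))"

definition krull_dim :: "('a, 'b) ring_scheme \<Rightarrow> enat" where
  "krull_dim A =
     (SUP l \<in> {l. \<exists>P :: nat \<Rightarrow> 'a set.
                    (\<forall>i\<le>l. primeideal (P i) A) \<and> (\<forall>i<l. P i \<subset> P (Suc i))}. enat l)"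

definition embedding_dim :: "('a, 'b) ring_scheme \<Rightarrow> 'a set \<Rightarrow> nat" where
  "embedding_dim A m =
     (LEAST l. \<exists>S \<subseteq> carrier A. finite S \<and> card S = l \<and> m = Idl\<^bsub>A\<^esub> S)"

definition regular_local_ring :: "('a, 'b) ring_scheme \<Rightarrow> 'a set \<Rightarrow> bool" where
  "regular_local_ring A m \<longleftrightarrow> local_ring A m \<and> enat (embedding_dim A m) = krull_dim A"


section \<open>Formal power series in \<open>X\<^sub>1, \<dots>, X\<^sub>n\<close>\<close>

text \<open>A monomial is the multiset of the indices of its variables, so that multiplication of
  monomials is multiset sum and divisibility is \<open>\<subseteq>#\<close>. A series is its coefficient function.\<close>

type_synonym 'a mps = "nat multiset \<Rightarrow> 'a"

definition mps_ring :: "nat \<Rightarrow> ('a::comm_ring_1) mps ring" where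
  "mps_ring n =
     \<lparr>carrier = {f. \<forall>p. f p \<noteq> 0 \<longrightarrow> set_mset p \<subseteq> {1..n}},
      monoid.mult = (\<lambda>f g p. \<Sum>q\<in>{q. q \<subseteq># p}. f q * g (p - q)),
      monoid.one = (\<lambda>p. if p = {#} then 1 else 0),
      ring.zero = (\<lambda>p. 0),
      ring.add = (\<lambda>f g p. f p + g p)\<rparr>"

definition mps_const :: "'a::comm_ring_1 \<Rightarrow> 'a mps" where
  "mps_const b = (\<lambda>p. if p = {#} then b else 0)"

definition mps_X :: "nat \<Rightarrow> ('a::comm_ring_1) mps" where
  "mps_X i = (\<lambda>p. if p = {#i#} then 1 else 0)"

definition mps_X_ideal :: "nat \<Rightarrow> ('a::comm_ring_1) mps set" where
  "mps_X_ideal n = Idl\<^bsub>mps_ring n\<^esub> (mps_X ` {1..n})"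


section \<open>Fractions, integral closure and conductor of a subring of a field\<close>

definition integral_over :: "'b::comm_ring_1 set \<Rightarrow> 'b \<Rightarrow> bool" where
  "integral_over R z \<longleftrightarrow>
     (\<exists>p :: 'b Polynomial.poly. Polynomial.lead_coeff p = 1 \<and>
        (\<forall>i. Polynomial.coeff p i \<in> R) \<and> Polynomial.poly p z = 0)"

definition fractions :: "'b::field set \<Rightarrow> 'b set" where
  "fractions R = {f / g | f g. f \<in> R \<and> g \<in> R \<and> g \<noteq> 0}"

definition integral_closure :: "'b::field set \<Rightarrow> 'b set" where
  "integral_closure R = {z \<in> fractions R. integral_over R z}"

definition conductor :: "'b::field set \<Rightarrow> 'b set" where
  "conductor R = {z \<in> fractions R. \<forall>y \<in> integral_closure R. z * y \<in> R}"


section \<open>Subrings of the field of Laurent series\<close>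

text \<open>\<open>\<k>[[t]]\<close> is \<open>range fps_to_fls\<close> inside \<open>\<k>((t))\<close>, which is the type \<open>'a fls\<close> with \<open>t = fls_X\<close>.\<close>

abbreviation laurent_subring :: "('a::field) fls set \<Rightarrow> 'a fls ring" where
  "laurent_subring R \<equiv> ring_of_type_algebra\<lparr>carrier := R\<rparr>"

definition valuation_semigroup :: "('a::field) fls set \<Rightarrow> int set" where
  "valuation_semigroup R = {fls_subdegree r | r. r \<in> R \<and> r \<noteq> 0}"

definition conductor_valuation :: "('a::field) fls set \<Rightarrow> nat \<Rightarrow> bool" where
  "conductor_valuation R c \<longleftrightarrow>
     c > 0 \<and> fls_X ^ (c - 1) \<notin> R \<and> (\<forall>i. fls_X ^ (c + i) \<in> R)"

text \<open>The quotient of \<open>\<CC> + x R\<close> by \<open>x R\<close> is taken inside the \<open>\<k>\<close>-algebra \<open>R / x R\<close>, in which \<open>\<k>\<close> is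
  the image of the constants. Here \<open>ring.dim B K E\<close> is the dimension of \<open>E \<subseteq> B\<close> over the
  subfield \<open>K\<close> of the ring \<open>B\<close>; it is unspecified if that dimension is infinite.\<close>

definition reduced_type :: "('a::field) fls set \<Rightarrow> 'a fls \<Rightarrow> nat" where
  "reduced_type R x =
     (let A = laurent_subring R;
          J = PIdl\<^bsub>A\<^esub> x;
          proj = (\<lambda>r. J +>\<^bsub>A\<^esub> r)
      in ring.dim (A Quot J) (proj ` range fls_const) (proj ` (conductor R <+>\<^bsub>A\<^esub> J)))"

end

theory Submission
  imports Defs
begin

text \<open>
  Write \<open>t\<^sup>d \<k>[[t]]\<close> as \<^term>\<open>fls_ge d\<close>. Since \<open>t\<^sup>c \<in> m\<close> and \<open>m \<subseteq> t \<k>[[t]]\<close>, the \<open>t\<close>-adic partial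
  sums of an element of \<open>t\<^sup>c \<k>[[t]]\<close> are \<open>m\<close>-adically Cauchy with the same limit, so completeness
  gives \<open>t\<^sup>c \<k>[[t]] \<subseteq> R\<close> and this is the conductor. The images of \<open>t\<^sup>d \<k>[[t]]\<close> in \<open>R / x\<^sub>1 R\<close> for
  \<open>c \<le> d \<le> c + a\<^sub>1\<close> form a filtration that ends in \<open>0\<close>, because
  \<open>t\<^bsup>c + a\<^sub>1\<^esup> \<k>[[t]] = x\<^sub>1 t\<^sup>c \<k>[[t]]\<close>. The step at \<open>d\<close> drops by the class of \<open>t\<^sup>d\<close> if no element of
  \<open>x\<^sub>1 R\<close> has order \<open>d\<close>, that is, if \<open>d - a\<^sub>1 \<notin> v(R)\<close>, and it is trivial otherwise.
\<close>

section \<open>The order filtration of the field of Laurent series\<close>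

unbundle fps_syntax

text \<open>Vanishing of coefficients is used instead of a bound on \<open>fls_subdegree\<close>,
  because \<open>fls_subdegree 0 = 0\<close> would exclude the zero series for positive d.\<close>

definition fls_ge :: "int \<Rightarrow> 'a::field fls set" where
  "fls_ge d = {f. \<forall>k<d. f $$ k = 0}"

lemma fls_ge_iff: "f \<in> fls_ge d \<longleftrightarrow> f = 0 \<or> d \<le> fls_subdegree f"
  unfolding fls_ge_def using fls_subdegree_geI[of f d] by auto

lemma fls_ge_mono: "d \<le> e \<Longrightarrow> fls_ge e \<subseteq> fls_ge d"
  by (auto simp: fls_ge_def)

lemma fls_ge_mult: "f \<in> fls_ge d \<Longrightarrow> g \<in> fls_ge e \<Longrightarrow> f * g \<in> fls_ge (d + e)"
  by (cases "f = 0 \<or> g = 0") (auto simp: fls_ge_iff)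

lemma fls_ge_add: "f \<in> fls_ge d \<Longrightarrow> g \<in> fls_ge d \<Longrightarrow> f + g \<in> fls_ge d"
  by (auto simp: fls_ge_def)

lemma fls_ge_diff: "f \<in> fls_ge d \<Longrightarrow> g \<in> fls_ge d \<Longrightarrow> f - g \<in> fls_ge d"
  by (auto simp: fls_ge_def)

lemma range_fps_to_fls: "range fps_to_fls = (fls_ge 0 :: 'a::field fls set)"
proof (intro equalityI subsetI)
  fix f :: "'a fls"
  assume "f \<in> fls_ge 0"
  then have "fls_subdegree f \<ge> 0"
    by (auto simp: fls_ge_iff)
  then have "f = fps_to_fls (fls_regpart f)"
    by simp
  then show "f \<in> range fps_to_fls"
    by blast
qed (auto simp: fls_ge_iff fls_subdegree_fls_to_fps_gt0)

lemma fls_ge_divide: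
  assumes "f \<in> fls_ge (d + e)" "g \<noteq> 0" "fls_subdegree g = d"
  shows "f / g \<in> fls_ge e"
  using assms by (auto simp: fls_ge_iff fls_divide_subdegree)

lemma fls_ge_SucI:
  assumes "f \<in> fls_ge d" "f $$ d = 0"
  shows "f \<in> fls_ge (d + 1)"
proof -
  have "f $$ k = 0" if "k < d + 1" for k
    using assms that by (cases "k = d") (auto simp: fls_ge_def)
  then show ?thesis
    by (simp add: fls_ge_def)
qed

text \<open>Cancellation of leading terms: g has order exactly d, so its coefficient there is
  invertible, and a constant multiple of g removes the coefficient of t^d from f.\<close>

lemma fls_ge_reduce:
  assumes f: "f \<in> fls_ge d" and g: "g \<noteq> 0" "fls_subdegree g = d"
  shows "f - fls_const (f $$ d / g $$ d) * g \<in> fls_ge (d + 1)"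
proof (rule fls_ge_SucI)
  have "g \<in> fls_ge d"
    using g by (simp add: fls_ge_iff)
  then have "fls_const (f $$ d / g $$ d) * g \<in> fls_ge d"
    by (auto simp: fls_ge_def)
  then show "f - fls_const (f $$ d / g $$ d) * g \<in> fls_ge d"
    by (rule fls_ge_diff[OF f])
  have "g $$ d \<noteq> 0"
    using g nth_fls_subdegree_nonzero by blast
  then show "(f - fls_const (f $$ d / g $$ d) * g) $$ d = 0"
    by simp
qed

lemma ring_of_type_algebra_simps [simp]:
  "f \<otimes>\<^bsub>ring_of_type_algebra\<^esub> g = f * g" "f \<oplus>\<^bsub>ring_of_type_algebra\<^esub> g = f + g"
  "\<zero>\<^bsub>ring_of_type_algebra\<^esub> = 0" "\<one>\<^bsub>ring_of_type_algebra\<^esub> = 1"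
  by (simp_all add: ring_of_type_algebra_def)

section \<open>Subalgebras of the Laurent series field that contain the constants\<close>

locale laurent_subalgebra =
  fixes R :: "('a::field) fls set"
  assumes subdomain: "subdomain R ring_of_type_algebra"
    and const_mem: "fls_const b \<in> R"
begin

abbreviation "A \<equiv> laurent_subring R"

sublocale A: domain A
proof -
  interpret T: ring "ring_of_type_algebra :: 'a fls ring"
    by (rule ring_from_type_algebra)
  show "domain A"
    using subdomain T.subdomain_iff[of R] by (auto simp: ring_of_type_algebra_def)
qed

lemma mult_mem: "f \<in> R \<Longrightarrow> g \<in> R \<Longrightarrow> f * g \<in> R"
  using A.m_closed by simp

lemma add_mem: "f \<in> R \<Longrightarrow> g \<in> R \<Longrightarrow> f + g \<in> R"
  using A.a_closed by simp

lemma zero_mem: "0 \<in> R" and one_mem: "1 \<in> R"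
  using A.zero_closed A.one_closed by simp_all

lemma uminus_mem: "f \<in> R \<Longrightarrow> - f \<in> R"
  using mult_mem[OF const_mem[of "-1"], of f] by simp

lemma a_inv_A: "f \<in> R \<Longrightarrow> \<ominus>\<^bsub>A\<^esub> f = - f"
  using A.minus_equality[of "- f" f] uminus_mem by simp

lemma a_minus_A [simp]: "g \<in> R \<Longrightarrow> f \<ominus>\<^bsub>A\<^esub> g = f - g"
  by (simp add: a_minus_def a_inv_A)

lemma power_mem: "f \<in> R \<Longrightarrow> f ^ (k::nat) \<in> R"
  by (induction k) (auto simp: one_mem mult_mem)

lemma sum_mem: "(\<And>i. i \<in> S \<Longrightarrow> f i \<in> R) \<Longrightarrow> sum f S \<in> R"
  by (induction S rule: infinite_finite_induct) (auto simp: zero_mem add_mem)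

text \<open>Multiplying a monic equation of degree d for the inverse of r by r^(d-1) leaves the
  inverse itself as leading term, while all other terms become multiples of nonnegative powers of r
  with coefficients in R.\<close>

lemma inverse_mem_of_integral:
  assumes r: "r \<in> R" "r \<noteq> 0" and integral: "integral_over R (inverse r)"
  shows "inverse r \<in> R"
proof -
  obtain p where p: "Polynomial.lead_coeff p = 1" "\<And>i. Polynomial.coeff p i \<in> R" "Polynomial.poly p (inverse r) = 0"
    using integral unfolding integral_over_def by auto
  define d where "d = Polynomial.degree p"
  \<comment> \<open>A monic constant polynomial is 1 and has no root.\<close>
  have "d \<noteq> 0"
  proof
    assume "d = 0"
    then obtain b where "p = [:b:]"
      unfolding d_def by (metis degree_eq_zeroE)
    then show False
      using p by auto
  qed
  have "0 = r ^ (d - 1) * (\<Sum>i\<le>d. Polynomial.coeff p i * inverse r ^ i)"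
    using p(3) by (simp add: poly_altdef d_def)
  also have "\<dots> = (\<Sum>i\<le>d. Polynomial.coeff p i * (r ^ (d - 1) * inverse r ^ i))"
    by (simp add: sum_distrib_left mult_ac)
  also have "{..d} = insert d {..<d}"
    by auto
  also have "(\<Sum>i\<in>insert d {..<d}. Polynomial.coeff p i * (r ^ (d - 1) * inverse r ^ i)) =
      r ^ (d - 1) * inverse r ^ d + (\<Sum>i<d. Polynomial.coeff p i * (r ^ (d - 1) * inverse r ^ i))"
    using p(1) by (simp add: d_def)
  also have "r ^ (d - 1) * inverse r ^ d = inverse r"
    using \<open>d \<noteq> 0\<close> r(2) by (cases d) (auto simp: field_simps)
  also have "(\<Sum>i<d. Polynomial.coeff p i * (r ^ (d - 1) * inverse r ^ i)) = (\<Sum>i<d. Polynomial.coeff p i * r ^ (d - 1 - i))"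
  proof (rule sum.cong)
    fix i assume "i \<in> {..<d}"
    then have "r ^ (d - 1) = r ^ (d - 1 - i) * r ^ i"
      by (simp flip: power_add)
    then show "Polynomial.coeff p i * (r ^ (d - 1) * inverse r ^ i) = Polynomial.coeff p i * r ^ (d - 1 - i)"
      using r(2) by (simp add: field_simps)
  qed simp
  finally have "inverse r = - (\<Sum>i<d. Polynomial.coeff p i * r ^ (d - 1 - i))"
    by (metis add_eq_0_iff2 add.commute)
  then show ?thesis
    using p(2) r(1) by (auto intro!: uminus_mem sum_mem mult_mem power_mem)
qed

section \<open>Dimensions along the filtration modulo a principal ideal\<close>

lemma mem_PIdl_iff: "f \<in> PIdl\<^bsub>A\<^esub> x \<longleftrightarrow> (\<exists>r\<in>R. f = x * r)"
  by (auto simp: cgenideal_def mult.commute)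

lemma dimension_quotient:
  assumes x: "x \<in> R" "x \<noteq> 0" "fls_subdegree x = int a"
    and c: "fls_ge (int c) \<subseteq> R"
    and i: "i \<le> a"
  defines "J \<equiv> PIdl\<^bsub>A\<^esub> x"
  defines "pr \<equiv> (\<lambda>r. J +>\<^bsub>A\<^esub> r)"
  shows "ring.dimension (A Quot J) (card {j \<in> {int c - int i..int c - 1}. j \<notin> valuation_semigroup R})
    (pr ` range fls_const) (pr ` fls_ge (int (c + a - i)))"
  using i
proof (induction i)
  interpret J: ideal J A
    unfolding J_def using x by (auto intro: A.cgenideal_ideal)
  interpret B: ring "A Quot J"
    by (rule J.quotient_is_ring)
  interpret H: ring_hom_ring A "A Quot J" "(+>\<^bsub>A\<^esub>) J"
    by (rule J.rcos_ring_hom_ring)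
  have zero: "pr 0 = \<zero>\<^bsub>A Quot J\<^esub>"
    using H.hom_zero by (simp add: pr_def)
  have pr_eq: "pr f = pr g \<longleftrightarrow> f - g \<in> J" if "f \<in> R" "g \<in> R" for f g
    using A.quotient_eq_iff_same_a_r_cos[OF J.is_ideal, of f g] that by (simp add: pr_def)
  {
    case 0
    \<comment> \<open>Division by x lowers the order by a, so the quotient has order at least c and
      lies in R.\<close>
    have "fls_ge (int (c + a)) \<subseteq> J"
    proof
      fix f :: "'a fls"
      assume "f \<in> fls_ge (int (c + a))"
      then have "f / x \<in> fls_ge (int c)"
        using x by (intro fls_ge_divide[where d = "int a"]) (auto simp: add.commute)
      then show "f \<in> J"
        unfolding J_def mem_PIdl_iff using c x(2) by (intro bexI[of _ "f / x"]) auto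
    qed
    then have "pr f = \<zero>\<^bsub>A Quot J\<^esub>" if "f \<in> fls_ge (int (c + a))" for f
      using pr_eq[of f 0] that zero zero_mem J.Icarr by auto
    moreover have "0 \<in> fls_ge (int (c + a))"
      by (simp add: fls_ge_iff)
    ultimately have "pr ` fls_ge (int (c + a)) = {\<zero>\<^bsub>A Quot J\<^esub>}"
      by blast
    moreover have "{j \<in> {int c - int 0..int c - 1}. j \<notin> valuation_semigroup R} = {}"
      by auto
    ultimately show ?case
      using B.zero_dim by simp
  next
    case (Suc i)
    \<comment> \<open>The new step adds the order d. The integer to be tested for being a gap is d -
      a = c - (i + 1), exactly the one that enlarges the interval.\<close>
    define d where "d = c + a - Suc i"
    define N where "N i = {j \<in> {int c - int i..int c - 1}. j \<notin> valuation_semigroup R}" for i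
    have d: "c \<le> d" "int (c + a - i) = int d + 1" "int d - int a = int c - int (Suc i)"
      using Suc.prems by (auto simp: d_def)
    have IH: "B.dimension (card (N i)) (pr ` range fls_const) (pr ` fls_ge (int d + 1))"
      using Suc d by (simp add: N_def)
    have sub: "fls_ge (int d + 1) \<subseteq> fls_ge (int d)" "fls_ge (int d) \<subseteq> R"
      using c d fls_ge_mono[of "int d" "int d + 1"] fls_ge_mono[of "int c" "int d"] by auto
    have N: "N (Suc i) = (if int d - int a \<in> valuation_semigroup R then N i else insert (int d - int a) (N i))"
    proof -
      have "{int c - int (Suc i)..int c - 1} = insert (int c - int (Suc i)) {int c - int i..int c - 1}"
        by auto
      then show ?thesis
        unfolding N_def d(3) by auto
    qed
    have "B.dimension (card (N (Suc i))) (pr ` range fls_const) (pr ` fls_ge (int d))"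
    proof (cases "int d - int a \<in> valuation_semigroup R")
      case True
      then obtain r where r: "r \<in> R" "r \<noteq> 0" "fls_subdegree r = int d - int a"
        unfolding valuation_semigroup_def by auto
      \<comment> \<open>Here x * r is an element of J of order d, so every term of order d can be
        removed modulo J and the image does not grow.\<close>
      have "pr ` fls_ge (int d) \<subseteq> pr ` fls_ge (int d + 1)"
      proof
        fix y assume "y \<in> pr ` fls_ge (int d)"
        then obtain f where f: "f \<in> fls_ge (int d)" "y = pr f"
          by auto
        define b where "b = fls_const (f $$ int d / (x * r) $$ int d)"
        have g: "f - b * (x * r) \<in> fls_ge (int d + 1)"
          unfolding b_def using r x by (intro fls_ge_reduce f) auto
        have "f - (f - b * (x * r)) = x * (b * r)"
          by (simp add: algebra_simps)
        then have "f - (f - b * (x * r)) \<in> J"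
          unfolding J_def mem_PIdl_iff using r(1) const_mem b_def mult_mem by blast
        then have "pr f = pr (f - b * (x * r))"
          using f g sub by (subst pr_eq) auto
        then show "y \<in> pr ` fls_ge (int d + 1)"
          using f g by blast
      qed
      then have "pr ` fls_ge (int d) = pr ` fls_ge (int d + 1)"
        using sub by blast
      then show ?thesis
        using IH N True by simp
    next
      case False
      define v where "v = pr (fls_X ^ d)"
      have X: "fls_X ^ d \<in> fls_ge (int d)" "fls_X ^ d \<in> R"
        using sub by (auto simp: fls_ge_iff)
      have v: "v \<in> carrier (A Quot J)"
        using X ring_hom_memE(1)[OF J.rcos_ring_hom] by (simp add: v_def pr_def)
      \<comment> \<open>If t^d were congruent to some f of order above d, then t^d - f = x * r would
        have order d, and r would have the order d - a, which is a gap.\<close>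
      have notin: "v \<notin> pr ` fls_ge (int d + 1)"
      proof
        assume "v \<in> pr ` fls_ge (int d + 1)"
        then obtain f where f: "f \<in> fls_ge (int d + 1)" "pr (fls_X ^ d) = pr f"
          unfolding v_def by auto
        then have "fls_X ^ d - f \<in> J"
          using X sub pr_eq by blast
        then obtain r where r: "r \<in> R" "fls_X ^ d - f = x * r"
          unfolding J_def mem_PIdl_iff by auto
        have "fls_subdegree (x * r) = int d"
          unfolding r(2)[symmetric] using f(1)
          by (intro fls_subdegree_eqI) (auto simp: fls_ge_def)
        moreover have "x * r \<noteq> 0"
        proof -
          have "(fls_X ^ d - f) $$ int d \<noteq> 0"
            using f(1) by (auto simp: fls_ge_def)
          then show ?thesis
            unfolding r(2)[symmetric] by force
        qed
        ultimately have "fls_subdegree r = int d - int a" "r \<noteq> 0"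
          using x by auto
        moreover from this have "fls_subdegree r \<in> valuation_semigroup R"
          unfolding valuation_semigroup_def using r(1) by blast
        ultimately show False
          using False by simp
      qed
      \<comment> \<open>A series of order at least d is a constant times t^d plus a series of order
        at least d + 1. This decomposition is carried through the quotient map.\<close>
      have "pr ` fls_ge (int d) = B.line_extension (pr ` range fls_const) v (pr ` fls_ge (int d + 1))"
        (is "?L = ?R")
      proof -
        have comb: "pr (fls_const b) \<otimes>\<^bsub>A Quot J\<^esub> v \<oplus>\<^bsub>A Quot J\<^esub> pr g = pr (fls_const b * fls_X ^ d + g)"
          if "g \<in> R" for b g
          using ring_hom_memE(2,3)[OF J.rcos_ring_hom] that X const_mem mult_mem
          by (simp add: v_def pr_def)
        have "?R = (\<Union>b. \<Union>g\<in>fls_ge (int d + 1). {pr (fls_const b) \<otimes>\<^bsub>A Quot J\<^esub> v \<oplus>\<^bsub>A Quot J\<^esub> pr g})"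
          unfolding B.line_extension_def set_add_def' r_coset_def by blast
        also have "\<dots> = (\<Union>b. \<Union>g\<in>fls_ge (int d + 1). {pr (fls_const b * fls_X ^ d + g)})"
        proof (intro SUP_cong refl)
          fix b and g :: "'a fls"
          assume "g \<in> fls_ge (int d + 1)"
          then have "g \<in> R"
            using sub by blast
          then show "{pr (fls_const b) \<otimes>\<^bsub>A Quot J\<^esub> v \<oplus>\<^bsub>A Quot J\<^esub> pr g} = {pr (fls_const b * fls_X ^ d + g)}"
            by (simp only: comb)
        qed
        also have "\<dots> = pr ` {fls_const b * fls_X ^ d + g | b g. g \<in> fls_ge (int d + 1)}"
          by blast
        also have "{fls_const b * fls_X ^ d + g | b g. g \<in> fls_ge (int d + 1)} = (fls_ge (int d) :: 'a fls set)"
        proof (intro equalityI subsetI)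
          fix f :: "'a fls"
          assume "f \<in> {fls_const b * fls_X ^ d + g | b g. g \<in> fls_ge (int d + 1)}"
          then obtain b g where "f = fls_const b * fls_X ^ d + g" "g \<in> fls_ge (int d)"
            using sub by auto
          moreover have "fls_const b * fls_X ^ d \<in> fls_ge (int d)"
            by (auto simp: fls_ge_def)
          ultimately show "f \<in> fls_ge (int d)"
            using fls_ge_add by blast
        next
          fix f :: "'a fls" assume "f \<in> fls_ge (int d)"
          from fls_ge_reduce[OF this, of "fls_X ^ d"]
          have "f - fls_const (f $$ int d) * fls_X ^ d \<in> fls_ge (int d + 1)"
            by simp
          moreover have "f = fls_const (f $$ int d) * fls_X ^ d + (f - fls_const (f $$ int d) * fls_X ^ d)"
            by simp
          ultimately show "f \<in> {fls_const b * fls_X ^ d + g | b g. g \<in> fls_ge (int d + 1)}"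
            by blast
        qed
        finally show ?thesis
          by (rule sym)
      qed
      moreover have "card (N (Suc i)) = Suc (card (N i))"
      proof -
        have "finite (N i)"
          unfolding N_def by (rule finite_subset[of _ "{int c - int i..int c - 1}"]) auto
        moreover have "int d - int a \<notin> N i"
          by (simp add: N_def d(3))
        ultimately show ?thesis
          using False N by simp
      qed
      ultimately show ?thesis
        using B.Suc_dim[OF v notin IH] by simp
    qed
    then show ?case
      by (simp add: N_def d_def)
  }
qed

section \<open>From the dimension predicate to the reduced type\<close>

lemma subfield_const: "subfield (range fls_const) A"
proof (rule A.subfieldI)
  show "subcring (range fls_const) A"
  proof (rule A.subcringI')
    show "subring (range fls_const) A"
    proof (rule A.subringI)
      fix h :: "'a fls"
      assume "h \<in> range fls_const"
      then obtain b where "h = fls_const b" by blast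
      then show "\<ominus>\<^bsub>A\<^esub> h \<in> range fls_const"
        using a_inv_A[OF const_mem[of b]] by (metis fls_const_uminus rangeI)
    qed (use const_mem in \<open>auto simp: fls_plus_const simp flip: fls_const_1\<close>)
  qed
  show "Units (A\<lparr>carrier := range fls_const\<rparr>) = range fls_const - {\<zero>\<^bsub>A\<^esub>}"
  proof (intro equalityI subsetI)
    fix h assume "h \<in> range fls_const - {\<zero>\<^bsub>A\<^esub>}"
    then obtain b where "h = fls_const b" "b \<noteq> 0"
      by auto
    then have "\<exists>h'\<in>range fls_const. h' * h = 1 \<and> h * h' = 1"
      by (intro bexI[of _ "fls_const (inverse b)"]) auto
    then show "h \<in> Units (A\<lparr>carrier := range fls_const\<rparr>)"
      using \<open>h = fls_const b\<close> by (auto simp: Units_def)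
  qed (auto simp: Units_def)
qed

text \<open>Since \<open>ring.dim\<close> is a definite description, the dimension found along the
  filtration must also be shown to be unique. For a > 0 this is linear algebra over a field.
  Treating a = 0 separately avoids a proof that x lies in the maximal ideal.\<close>

lemma reduced_type_eq_card_gaps:
  assumes x: "x \<in> R" "x \<noteq> 0" "fls_subdegree x = int a"
    and unit: "a = 0 \<Longrightarrow> inverse x \<in> R"
    and R: "R \<subseteq> fls_ge 0"
    and conductor: "conductor R = fls_ge (int c)" "fls_ge (int c) \<subseteq> R"
  shows "reduced_type R x = card {j \<in> {int c - int a..int c - 1}. j \<notin> valuation_semigroup R}"
proof -
  define J where "J = PIdl\<^bsub>A\<^esub> x"
  define pr where "pr = (\<lambda>r. J +>\<^bsub>A\<^esub> r)"
  define K where "K = pr ` range fls_const"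
  define N where "N = card {j \<in> {int c - int a..int c - 1}. j \<notin> valuation_semigroup R}"
  interpret J: ideal J A
    unfolding J_def using x by (auto intro: A.cgenideal_ideal)
  interpret B: ring "A Quot J"
    by (rule J.quotient_is_ring)
  interpret H: ring_hom_ring A "A Quot J" "(+>\<^bsub>A\<^esub>) J"
    by (rule J.rcos_ring_hom_ring)
  have pr_eq: "pr f = pr g \<longleftrightarrow> f - g \<in> J" if "f \<in> R" "g \<in> R" for f g
    using A.quotient_eq_iff_same_a_r_cos[OF J.is_ideal, of f g] that by (simp add: pr_def)
  have "pr ` (conductor R <+>\<^bsub>A\<^esub> J) = pr ` fls_ge (int c)"
  proof (intro equalityI subsetI)
    fix y assume "y \<in> pr ` (conductor R <+>\<^bsub>A\<^esub> J)"
    then obtain f j where "f \<in> fls_ge (int c)" "j \<in> J" "y = pr (f + j)"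
      unfolding set_add_def' conductor(1) by auto
    moreover from this have "pr (f + j) = pr f"
      using conductor(2) J.Icarr add_mem by (subst pr_eq) auto
    ultimately show "y \<in> pr ` fls_ge (int c)"
      by blast
  next
    fix y assume "y \<in> pr ` fls_ge (int c)"
    then obtain f where f: "f \<in> fls_ge (int c)" "y = pr f"
      by auto
    have "f \<oplus>\<^bsub>A\<^esub> \<zero>\<^bsub>A\<^esub> \<in> conductor R <+>\<^bsub>A\<^esub> J"
      using f(1) J.zero_closed unfolding set_add_def' conductor(1) by blast
    then show "y \<in> pr ` (conductor R <+>\<^bsub>A\<^esub> J)"
      using f(2) by simp
  qed
  then have dim: "reduced_type R x = B.dim K (pr ` fls_ge (int c))"
    unfolding reduced_type_def Let_def J_def[symmetric] K_def pr_def by simp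
  have dimension: "B.dimension N K (pr ` fls_ge (int c))"
    using dimension_quotient[OF x conductor(2) order_refl]
    by (simp add: N_def K_def pr_def J_def)
  show ?thesis
  proof (cases "a = 0")
    case True
    txt \<open>The quotient ring is zero, so \<open>K\<close> is not a subfield and \<open>B.dimI\<close> does not apply.\<close>
    have "J = R"
    proof
      show "R \<subseteq> J"
      proof
        fix r assume "r \<in> R"
        then have "inverse x * r \<in> R" "r = x * (inverse x * r)"
          using unit[OF True] x(2) mult_mem by simp_all
        then show "r \<in> J"
          unfolding J_def mem_PIdl_iff by blast
      qed
    qed (use J.Icarr in auto)
    then have "pr r = pr 0" if "r \<in> R" for r
      using pr_eq that zero_mem by simp
    moreover have zero: "pr 0 = \<zero>\<^bsub>A Quot J\<^esub>"
      using H.hom_zero by (simp add: pr_def)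
    moreover have "carrier (A Quot J) = pr ` R"
      by (auto simp: FactRing_def A_RCOSETS_def' pr_def)
    ultimately have carrier: "carrier (A Quot J) = {\<zero>\<^bsub>A Quot J\<^esub>}"
      using zero_mem by force
    \<comment> \<open>In the zero ring there is no vector outside E, so no line extension can occur
      and every dimension is 0, whatever the scalars are.\<close>
    have "n = 0 \<and> E = {\<zero>\<^bsub>A Quot J\<^esub>}" if "B.dimension n L E" for n L E
      using that
    proof induction
      case (Suc_dim v E n K)
      then have "v \<in> E"
        unfolding carrier by blast
      with Suc_dim show ?case
        by blast
    qed simp
    then show ?thesis
      unfolding dim B.dim_def N_def[symmetric] using dimension by (metis the_equality)
  next
    case False
    \<comment> \<open>Elements of R have nonnegative order, so nonzero multiples of x have order at
      least a > 0. Hence the quotient is nonzero and the constants embed as a subfield.\<close>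
    have "1 \<notin> J"
    proof
      assume "1 \<in> J"
      then obtain r where r: "r \<in> R" "1 = x * r"
        unfolding J_def mem_PIdl_iff by auto
      then have "r \<noteq> 0" "r \<in> fls_ge 0"
        using R by auto
      then have "fls_subdegree r \<ge> 0"
        by (simp add: fls_ge_iff)
      then have "fls_subdegree (x * r) > 0"
        using x False \<open>r \<noteq> 0\<close> by simp
      then show False
        using r(2) by (metis fls_one_subdegree less_irrefl)
    qed
    then have "pr 1 \<noteq> pr 0"
      using pr_eq one_mem zero_mem by simp
    then have "\<one>\<^bsub>A Quot J\<^esub> \<noteq> \<zero>\<^bsub>A Quot J\<^esub>"
      using H.hom_zero H.hom_one by (simp add: pr_def)
    then have "subfield K (A Quot J)"
      unfolding K_def pr_def using H.img_is_subfield(2)[OF subfield_const] by simp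
    then show ?thesis
      unfolding dim using B.dimI[OF _ dimension] by (simp add: over_def N_def)
  qed
qed

section \<open>The conductor, and orders of elements of R and of m\<close>

lemma conductor_eq_fls_ge:
  assumes normalization: "integral_closure R = range fps_to_fls"
    and R: "fls_ge (int c) \<subseteq> R"
    and c: "conductor_valuation R c"
  shows "conductor R = fls_ge (int c)"
proof (intro equalityI subsetI)
  fix z assume z: "z \<in> conductor R"
  show "z \<in> fls_ge (int c)"
  proof (rule ccontr)
    assume "z \<notin> fls_ge (int c)"
    then have "z \<noteq> 0" "fls_subdegree z < int c"
      by (auto simp: fls_ge_iff)
    \<comment> \<open>An order below c makes t^(c-1) a multiple of z by a power series. As z is in
      the conductor, t^(c-1) would lie in R.\<close>
    then have "fls_X ^ (c - 1) / z \<in> fls_ge 0"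
      using c by (intro fls_ge_divide[where d = "fls_subdegree z"])
        (auto simp: fls_ge_iff conductor_valuation_def)
    then have "z * (fls_X ^ (c - 1) / z) \<in> R"
      using z normalization unfolding conductor_def range_fps_to_fls by auto
    then show False
      using \<open>z \<noteq> 0\<close> c by (simp add: conductor_valuation_def)
  qed
next
  fix z :: "'a fls"
  assume z: "z \<in> fls_ge (int c)"
  have "z / 1 \<in> fractions R"
    unfolding fractions_def using z R one_mem by force
  moreover have "z * y \<in> R" if "y \<in> integral_closure R" for y
    using fls_ge_mult[OF z, of y 0] that R by (auto simp: normalization range_fps_to_fls)
  ultimately show "z \<in> conductor R"
    by (simp add: conductor_def)
qed

text \<open>The inverse of a series of order 0 is a power series, hence integral over R by the
  assumption on the normalization.\<close>

lemma inverse_mem: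
  assumes normalization: "integral_closure R = range fps_to_fls"
    and r: "r \<in> R" "r \<noteq> 0" "fls_subdegree r = 0"
  shows "inverse r \<in> R"
proof -
  have "inverse r \<in> integral_closure R"
    unfolding normalization range_fps_to_fls using r by (simp add: fls_ge_iff)
  then show ?thesis
    using r by (intro inverse_mem_of_integral) (auto simp: integral_closure_def)
qed

text \<open>Each r in R is a root of the monic polynomial X - r, so it belongs to the integral
  closure.\<close>

lemma subset_fls_ge_0:
  assumes normalization: "integral_closure R = range fps_to_fls"
  shows "R \<subseteq> fls_ge 0"
proof
  fix r assume r: "r \<in> R"
  then have "r / 1 \<in> fractions R"
    unfolding fractions_def using one_mem by force
  moreover have "integral_over R r"
    unfolding integral_over_def using uminus_mem[OF r] zero_mem one_mem
    by (intro exI[of _ "[:- r, 1:]"]) (auto simp: coeff_pCons split: nat.split)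
  ultimately show "r \<in> fls_ge 0"
    using normalization by (auto simp: integral_closure_def range_fps_to_fls)
qed

text \<open>An element of R of order 0 is a unit of R and cannot lie in a proper ideal.\<close>

lemma maximal_ideal_subset_fls_ge_1:
  assumes normalization: "integral_closure R = range fps_to_fls"
    and m: "maximalideal m A"
  shows "m \<subseteq> fls_ge 1"
proof
  interpret m: maximalideal m A by fact
  fix r assume r: "r \<in> m"
  show "r \<in> fls_ge 1"
  proof (rule ccontr)
    assume "r \<notin> fls_ge 1"
    moreover have rR: "r \<in> R"
      using r m.Icarr by simp
    ultimately have "r \<noteq> 0" "fls_subdegree r = 0"
      using subset_fls_ge_0[OF normalization] by (auto simp: fls_ge_iff)
    then have "inverse r * r \<in> m"
      using m.I_l_closed[OF r, of "inverse r"] inverse_mem[OF normalization rR] by simp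
    then show False
      using m.one_imp_carrier m.I_notcarr \<open>r \<noteq> 0\<close> by simp
  qed
qed

section \<open>Completeness: m-adic limits as t-adic limits\<close>

lemma power_mem_ideal_power:
  assumes "ideal m A" "f \<in> m"
  shows "f ^ k \<in> m [^]\<^bsub>ideals_set A\<^esub> (k::nat)"
proof (induction k)
  case 0
  show ?case
    using one_mem by (simp add: nat_pow_def ideals_set_def)
next
  case (Suc k)
  then show ?case
    using ideal_prod.prod[OF Suc assms(2), of A]
    by (simp add: ideals_set_def mult.commute)
qed

text \<open>Orders add under multiplication. Thus m-adic convergence implies t-adic convergence,
  which identifies the limit supplied by completeness.\<close>

lemma ideal_power_subset_fls_ge:
  assumes normalization: "integral_closure R = range fps_to_fls"
    and m: "m \<subseteq> fls_ge 1"
  shows "m [^]\<^bsub>ideals_set A\<^esub> (k::nat) \<subseteq> fls_ge (int k)"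
proof (induction k)
  case 0
  show ?case
    using subset_fls_ge_0[OF normalization] by (simp add: nat_pow_def ideals_set_def)
next
  case (Suc k)
  have "f \<in> fls_ge (int (Suc k))" if "f \<in> ideal_prod A (m [^]\<^bsub>ideals_set A\<^esub> k) m" for f
    using that
  proof induction
    case (prod i j)
    then have "i * j \<in> fls_ge (int k + 1)"
      using Suc m by (intro fls_ge_mult) auto
    then show ?case
      by (simp add: add.commute)
  qed (simp add: fls_ge_add)
  then show ?case
    by (auto simp: ideals_set_def)
qed

text \<open>\<open>conductor_valuation\<close> only puts the monomials t^(c+i) into R. Infinite
  combinations of them are reached as m-adic limits.\<close>

lemma fls_ge_subset:
  assumes normalization: "integral_closure R = range fps_to_fls"
    and m: "maximalideal m A"
    and residue_field: "\<And>r. r \<in> R \<Longrightarrow> \<exists>b. r - fls_const b \<in> m"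
    and complete: "adically_complete A m"
    and c: "conductor_valuation R c"
  shows "fls_ge (int c) \<subseteq> R"
proof
  fix f :: "'a fls"
  assume f: "f \<in> fls_ge (int c)"
  interpret m: maximalideal m A by fact
  interpret I: comm_monoid "ideals_set A"
    by (rule A.ideals_set_is_comm_monoid)
  have power_ideal: "ideal (m [^]\<^bsub>ideals_set A\<^esub> k) A" for k :: nat
    using I.nat_pow_closed[of m k] m.is_ideal by (simp add: ideals_set_def)
  have m_ge: "m \<subseteq> fls_ge 1"
    by (rule maximal_ideal_subset_fls_ge_1[OF normalization m])
  have cpos: "c > 0" and X: "fls_X ^ (c + i) \<in> R" for i
    using c by (auto simp: conductor_valuation_def)
  have Xm: "fls_X ^ c \<in> m"
  proof -
    obtain b where b: "fls_X ^ c - fls_const b \<in> m"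
      using residue_field X[of 0] by auto
    \<comment> \<open>Since c > 0, the constant coefficient of this difference is -b, and it must
      vanish.\<close>
    then have "fls_X ^ c - fls_const b \<in> fls_ge 1"
      using m_ge by blast
    then have "b = 0"
      using cpos by (simp add: fls_ge_def split: if_splits)
    then show ?thesis
      using b by simp
  qed
  define h where "h i = fls_const (f $$ int (c + i)) * fls_X ^ (c + i)" for i
  \<comment> \<open>The terms are taken in blocks of length c, so that the block from s k to s (k +
    1) is divisible by (t^c)^k.\<close>
  define s where "s k = (\<Sum>i<c * k. h i)" for k
  have h: "h i \<in> R" for i
    unfolding h_def by (intro mult_mem const_mem X)
  then have s: "s k \<in> R" for k
    unfolding s_def by (intro sum_mem)
  have cauchy: "s (Suc k) \<ominus>\<^bsub>A\<^esub> s k \<in> m [^]\<^bsub>ideals_set A\<^esub> k" for k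
  proof -
    have "{..<c * Suc k} = {..<c * k} \<union> {c * k..<c * k + c}"
      by auto
    moreover have "sum h ({..<c * k} \<union> {c * k..<c * k + c}) = sum h {..<c * k} + sum h {c * k..<c * k + c}"
      by (rule sum.union_disjoint) auto
    ultimately have "s (Suc k) - s k = (\<Sum>i\<in>{c * k..<c * k + c}. h i)"
      unfolding s_def by (simp only: add_diff_cancel_left')
    \<comment> \<open>One further factor t^c stays in the cofactor, whose monomials then have
      exponent at least c and lie in R.\<close>
    also have "(\<Sum>i\<in>{c * k..<c * k + c}. h i) =
        (\<Sum>i\<in>{c * k..<c * k + c}. fls_const (f $$ int (c + i)) * fls_X ^ (c + (i - c * k))) * (fls_X ^ c) ^ k"
      unfolding sum_distrib_right
    proof (rule sum.cong)
      fix i assume "i \<in> {c * k..<c * k + c}"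
      then have "c + i = c + (i - c * k) + c * k"
        by simp
      then have "fls_X ^ (c + i) = fls_X ^ (c + (i - c * k)) * (fls_X ^ c :: 'a fls) ^ k"
        by (metis power_add power_mult)
      then show "h i = fls_const (f $$ int (c + i)) * fls_X ^ (c + (i - c * k)) * (fls_X ^ c) ^ k"
        by (simp add: h_def mult.assoc)
    qed simp
    also have "\<dots> \<in> m [^]\<^bsub>ideals_set A\<^esub> k"
    proof -
      have "(\<Sum>i\<in>{c * k..<c * k + c}. fls_const (f $$ int (c + i)) * fls_X ^ (c + (i - c * k))) \<in> R"
        by (intro sum_mem mult_mem const_mem X)
      with ideal.I_l_closed[OF power_ideal power_mem_ideal_power[OF m.is_ideal Xm]]
      show ?thesis
        by simp
    qed
    finally show ?thesis
      using s by simp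
  qed
  have "\<forall>s. (\<forall>k. s k \<in> carrier A) \<longrightarrow>
      (\<forall>k. s (Suc k) \<ominus>\<^bsub>A\<^esub> s k \<in> m [^]\<^bsub>ideals_set A\<^esub> k) \<longrightarrow>
      (\<exists>y\<in>carrier A. \<forall>k. y \<ominus>\<^bsub>A\<^esub> s k \<in> m [^]\<^bsub>ideals_set A\<^esub> k)"
    using complete unfolding adically_complete_def by (elim conjE)
  then have "\<exists>y\<in>carrier A. \<forall>k. y \<ominus>\<^bsub>A\<^esub> s k \<in> m [^]\<^bsub>ideals_set A\<^esub> k"
    using s cauchy by (elim allE[of _ s]) (auto simp del: a_minus_A)
  then obtain y where y: "y \<in> R" "\<And>k. y \<ominus>\<^bsub>A\<^esub> s k \<in> m [^]\<^bsub>ideals_set A\<^esub> k"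
    by auto
  have "y $$ j = f $$ j" for j
  proof (cases "j < 0")
    case True
    then show ?thesis
      using f y(1) subset_fls_ge_0[OF normalization] by (auto simp: fls_ge_def)
  next
    case False
    \<comment> \<open>With k = j + 1, y and s k agree at t^j. As c is at least 1, s k has at least k
      terms, starting at t^c, and so already contains the term of f at t^j.\<close>
    define k where "k = Suc (nat j)"
    have "y - s k \<in> fls_ge (int k)"
      using y(2)[of k] s ideal_power_subset_fls_ge[OF normalization m_ge] by auto
    then have "y $$ j = s k $$ j"
      using False by (simp add: fls_ge_def k_def)
    also have "s k $$ j = (\<Sum>i<c * k. if int (c + i) = j then f $$ j else 0)"
      unfolding s_def h_def fls_nth_sum by (intro sum.cong) auto
    also have "\<dots> = f $$ j"
    proof (cases "j < int c")
      case True
      then show ?thesis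
        using f by (auto simp: fls_ge_def intro!: sum.neutral)
    next
      case False
      define i where "i = nat (j - int c)"
      have "k \<le> c * k"
        using cpos by simp
      then have i: "int (c + i) = j" "i < c * k"
        using False by (auto simp: i_def k_def)
      then have "(\<Sum>i<c * k. if int (c + i) = j then f $$ j else 0) = (\<Sum>i'<c * k. if i' = i then f $$ j else 0)"
        by (intro sum.cong) auto
      then show ?thesis
        using i(2) by simp
    qed
    finally show ?thesis .
  qed
  then have "y = f"
    by (simp add: fls_eq_iff)
  then show "f \<in> R"
    using y(1) by simp
qed

end

theorem theorem2p13:
  fixes R m :: "('a::{alg_closed_field, field_char_0}) fls set"
    and n c :: nat
    and I :: "'a mps set"
    and \<psi> :: "'a mps set \<Rightarrow> 'a fls"
    and x :: "nat \<Rightarrow> 'a fls"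
    and \<alpha> :: "nat \<Rightarrow> 'a fps"
    and a :: "nat \<Rightarrow> nat"
  assumes domain: "subdomain R ring_of_type_algebra"
    and algebra: "range fls_const \<subseteq> R"
    and local: "local_ring (laurent_subring R) m"
    and residue_field:
      "bij_betw (\<lambda>b. m +>\<^bsub>laurent_subring R\<^esub> fls_const b) UNIV (carrier (laurent_subring R Quot m))"
    and complete: "adically_complete (laurent_subring R) m"
    and one_dimensional: "krull_dim (laurent_subring R) = 1"
    and non_regular: "\<not> regular_local_ring (laurent_subring R) m"
    and normalization: "integral_closure R = range fps_to_fls"
    and n: "n = embedding_dim (laurent_subring R) m" "n \<ge> 2"
    and I: "ideal I (mps_ring n)" "I \<subseteq> mps_X_ideal n [^]\<^bsub>ideals_set (mps_ring n)\<^esub> (2::nat)"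
    and presentation: "\<psi> \<in> ring_iso (mps_ring n Quot I) (laurent_subring R)"
      "\<And>b. \<psi> (I +>\<^bsub>mps_ring n\<^esub> mps_const b) = fls_const b"
    and x: "\<And>i. i \<in> {1..n} \<Longrightarrow> x i = \<psi> (I +>\<^bsub>mps_ring n\<^esub> mps_X i)"
    and \<alpha>: "\<And>i. i \<in> {1..n} \<Longrightarrow> \<alpha> i dvd 1"
      "\<And>i. i \<in> {1..n} \<Longrightarrow> x i = fps_to_fls (\<alpha> i) * fls_X ^ a i"
    and a: "strict_mono_on {1..n} a"
    and c: "conductor_valuation R c"
  shows "reduced_type R (x 1) =
    card {j \<in> {int c - int (a 1)..int c - 1}. j \<notin> valuation_semigroup R}"
proof -
  interpret laurent_subalgebra R
    using domain algebra by (intro laurent_subalgebra.intro) auto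
  have m: "maximalideal m A"
    using local by (auto simp: local_ring_def)
  interpret m: maximalideal m A by fact
  \<comment> \<open>Surjectivity of the map from the constants to the residue field is what is used
    here.\<close>
  have residue: "\<exists>b. r - fls_const b \<in> m" if "r \<in> R" for r
  proof -
    have "m +>\<^bsub>A\<^esub> r \<in> carrier (A Quot m)"
      using that by (auto simp: FactRing_def A_RCOSETS_def')
    then obtain b where "m +>\<^bsub>A\<^esub> r = m +>\<^bsub>A\<^esub> fls_const b"
      using residue_field unfolding bij_betw_def by blast
    then show ?thesis
      using A.quotient_eq_iff_same_a_r_cos[OF m.is_ideal, of r "fls_const b"] that const_mem by auto
  qed
  have ge: "fls_ge (int c) \<subseteq> R"
    by (rule fls_ge_subset[OF normalization m residue complete c])
  have one: "1 \<in> {1..n}"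
    using n by simp
  have "x 1 \<in> R"
  proof -
    interpret I: ideal I "mps_ring n" by fact
    have "mps_X 1 \<in> carrier (mps_ring n)"
      using one by (simp add: mps_ring_def mps_X_def)
    then have "I +>\<^bsub>mps_ring n\<^esub> mps_X 1 \<in> carrier (mps_ring n Quot I)"
      by (auto simp: FactRing_def A_RCOSETS_def')
    then show ?thesis
      using ring_iso_memE(1)[OF presentation(1)] x[OF one] by simp
  qed
  \<comment> \<open>A unit power series has nonzero constant coefficient, so the order of x 1 comes
    from the power of t alone.\<close>
  have \<alpha>1: "\<alpha> 1 \<noteq> 0" "subdegree (\<alpha> 1) = 0"
    using \<alpha>(1)[OF one] by (auto simp: fps_is_unit_iff)
  then have x1: "x 1 \<noteq> 0" "fls_subdegree (x 1) = int (a 1)"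
    unfolding \<alpha>(2)[OF one] by (simp_all add: fls_subdegree_fls_to_fps)
  show ?thesis
    using \<open>x 1 \<in> R\<close> x1 inverse_mem[OF normalization] subset_fls_ge_0[OF normalization]
      conductor_eq_fls_ge[OF normalization ge c] ge
    by (intro reduced_type_eq_card_gaps) auto
qed

end
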